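(* Let $\rho_0,\rho_1:\mathbb{R}\to[0,\infty)$ be functions such that, for $j=0,1$: $\rho_j$ is symmetric around zero, $\rho_j(0)=0$, $\rho_j$ is continuous at zero, and there is a finite constant $c_j>0$ such that $\rho_j$ is non-decreasing on $[0,c_j]$ and constant on $[c_j,\infty)$. Suppose $\rho_1/\sup\rho_1\le\rho_0/\sup\rho_0$ and $\rho_1$ is continuous. Suppose that $\theta\mapsto\mathbf V(\theta)$ is continuous on $\Theta$; that $\mathbf V(\theta)=\mathbf I_k$ for some $\theta\in\Theta$, and for every $\theta\in\Theta$ and $\alpha>0$ there is $\theta'\in\Theta$ with $\alpha\mathbf V(\theta)=\mathbf V(\theta')$; and that the pre-image under $\theta\mapsto\mathbf V(\theta)$ of every bounded set is bounded. Let $0<b_0<\sup\rho_0$ and $r_0=b_0/\sup\rho_0$. For a collection $\mathcal S_n=\{\mathbf s_1,\dots,\mathbf s_n\}\subset\mathbb R^k\times\mathcal X$, with $\mathbf s_i=(\mathbf y_i,\mathbf X_i)$, let $(\beta_{0,n},\theta_{0,n})=(\beta_0(\mathbb P_n),\theta_0(\mathbb P_n))\in\mathbb R^q\times\Theta$ be the pair of initial estimators, where $\mathbb P_n$ is the empirical measure of $\mathcal S_n$, and let $\sigma_n>0$ be a solution in $\sigma$ of $$\frac1n\sum_{i=1}^n\rho_0\left(\frac{\sqrt{(\mathbf y_i-\mathbf X_i\beta_{0,n})^T\Gamma(\theta_{0,n})^{-1}(\mathbf y_i-\mathbf X_i\beta_{0,n})}}{\sigma}\right)=b_0 .$$ Let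 $\kappa(\mathcal S_n)$ be the maximal number of points of $\mathcal S_n$ lying on the same hyperplane in $\mathbb R^k\times\mathcal X$. If $\kappa(\mathcal S_n)+1\le n(1-r_0)$, then there exists a pair $(\beta_{1,n},\gamma_n)\in\mathfrak D$ that minimizes $$R_n(\beta,\mathbf V(\gamma))=\frac1n\sum_{i=1}^n\rho_1\left(\frac{\sqrt{(\mathbf y_i-\mathbf X_i\beta)^T\mathbf V(\gamma)^{-1}(\mathbf y_i-\mathbf X_i\beta)}}{\sigma_n}\right)$$ over $(\beta,\gamma)\in\mathfrak D$, and a vector $\theta_{1,n}$ that is the unique solution of $\mathbf V(\theta)=\sigma_n^2\mathbf V(\gamma_n)$ in $\Theta$.
   Context: Fix positive integers $k,q,l$. A point $\mathbf s=(\mathbf y,\mathbf X)$ consists of $\mathbf y\in\mathbb R^k$ and a $k\times q$ matrix $\mathbf X$ with rows $\mathbf x_1^T,\dots,\mathbf x_k^T$; it is identified with $\mathbf s^T=(\mathbf y^T,\mathbf x_1^T,\dots,\mathbf x_k^T)\in\mathbb R^k\times\mathbb R^{kq}$. $\mathcal X\subset\mathbb R^{kq}$ is the subset with the lowest dimension $p=\dim(\mathcal X)\le kq$ satisfying $P(\mathbf X\in\mathcal X)=1$, where $P$ is the distribution of the observations, so that $\mathbb R^k\times\mathcal X$ has dimension $k+p$ and hyperplanes in it have dimension $k+p-1$. $\mathrm{PDS}(k)$ is the set of positive definite symmetric $k\times k$ matrices; $|\mathbf A|$ is the determinant. $\Theta\subset\mathbb R^l$ and $\mathbf V:\Theta\to\mathrm{PDS}(k)$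 is a known identifiable map: $\mathbf V(\theta_1)=\mathbf V(\theta_2)$ implies $\theta_1=\theta_2$. Put $\Gamma(\theta)=\mathbf V(\theta)/|\mathbf V(\theta)|^{1/k}$ and $\mathfrak D=\{(\beta,\gamma)\in\mathbb R^q\times\Theta:\mathbf V(\gamma)\in\mathrm{PDS}(k),\ |\mathbf V(\gamma)|=1\}$. The initial functionals $Q\mapsto(\beta_0(Q),\theta_0(Q))$ are given and arbitrary.
   Formalization: The formal theorem additionally assumes that the image V(Θ) is closed relative to PDS(k); without this the claim fails, e.g. for V(a,t)=a·diag(e^t,e^{-t}) on Θ=(0,∞)×[0,1), where the minimizing sequence can leave Θ as t→1. *)

theory Defs
  imports "HOL-Probability.Probability"
begin

text \<open>
  A point \<open>(y, X)\<close> has a response vector \<open>y\<close> and a design matrix \<open>X\<close> with \<open>CARD('k)\<close> rows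
  and \<open>CARD('q)\<close> columns. The type is a Euclidean space of dimension
  \<open>CARD('k) + CARD('k) * CARD('q)\<close>, isomorphic to the space of the stacked vectors
  \<open>(y, x\<^sub>1, \<dots>, x\<^sub>k)\<close>.
\<close>

type_synonym ('k, 'q) point = "(real^'k) \<times> (real^'q^'k)"

definition PDS :: "(real^'k^'k) set" where
  "PDS = {A. transpose A = A \<and> (\<forall>x. x \<noteq> 0 \<longrightarrow> 0 < x \<bullet> (A *v x))}"

definition rho_function :: "(real \<Rightarrow> real) \<Rightarrow> bool" where
  "rho_function \<rho> \<longleftrightarrow>
     (\<forall>x. 0 \<le> \<rho> x) \<and> (\<forall>x. \<rho> (- x) = \<rho> x) \<and> \<rho> 0 = 0 \<and> isCont \<rho> 0 \<and>
     (\<exists>c>0. mono_on {0..c} \<rho> \<and> (\<forall>x\<ge>c. \<rho> x = \<rho> c))"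

text \<open>
  The dimension of a set of design matrices is the dimension of its affine hull, which is the
  notion of dimension for which hyperplanes have codimension one. A set that is not measurable
  has measure \<open>0\<close> and so does not compete in the minimality clause.
\<close>

definition minimal_design_set ::
    "('k::finite, 'q::finite) point measure \<Rightarrow> (real^'q^'k) set \<Rightarrow> bool" where
  "minimal_design_set P \<X> \<longleftrightarrow>
     measure P {s. snd s \<in> \<X>} = 1 \<and>
     (\<forall>\<Y>. measure P {s. snd s \<in> \<Y>} = 1 \<longrightarrow> aff_dim \<X> \<le> aff_dim \<Y>)"

text \<open>
  \<open>\<X>\<close> itself need not be affine (think of a polynomial regression design), so a hyperplane in
  \<open>UNIV \<times> \<X>\<close> is an affine subspace of the affine hull, of dimension \<open>k + p - 1\<close>.
\<close>

definition hyperplane_in ::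
    "(real^'q^'k) set \<Rightarrow> ('k::finite, 'q::finite) point set \<Rightarrow> bool" where
  "hyperplane_in \<X> H \<longleftrightarrow>
     affine H \<and> H \<subseteq> UNIV \<times> (affine hull \<X>) \<and>
     aff_dim H = int CARD('k) + aff_dim \<X> - 1"

text \<open>Points of the collection are counted with multiplicity.\<close>

definition kappa ::
    "(real^'q^'k) set \<Rightarrow> nat \<Rightarrow> (nat \<Rightarrow> ('k::finite, 'q::finite) point) \<Rightarrow> nat" where
  "kappa \<X> n s = Max {card {i \<in> {1..n}. s i \<in> H} |H. hyperplane_in \<X> H}"

definition empirical_measure ::
    "nat \<Rightarrow> (nat \<Rightarrow> 'a::topological_space) \<Rightarrow> 'a measure" where
  "empirical_measure n s = distr (uniform_count_measure {1..n}) borel s"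

definition mahalanobis ::
    "real^'k^'k \<Rightarrow> real^'q \<Rightarrow> ('k::finite, 'q::finite) point \<Rightarrow> real" where
  "mahalanobis A \<beta> s =
     sqrt ((fst s - snd s *v \<beta>) \<bullet> (matrix_inv A *v (fst s - snd s *v \<beta>)))"

definition mean_loss ::
    "(real \<Rightarrow> real) \<Rightarrow> nat \<Rightarrow> (nat \<Rightarrow> ('k::finite, 'q::finite) point) \<Rightarrow>
     real \<Rightarrow> real^'q \<Rightarrow> real^'k^'k \<Rightarrow> real" where
  "mean_loss \<rho> n s \<sigma> \<beta> A = (1 / real n) * (\<Sum>i=1..n. \<rho> (mahalanobis A \<beta> (s i) / \<sigma>))"

definition shape :: "real^'k^'k \<Rightarrow> real^'k^'k::finite" where
  "shape A = (1 / det A powr (1 / real CARD('k))) *\<^sub>R A"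

definition shape_domain ::
    "(real^'l) set \<Rightarrow> (real^'l \<Rightarrow> real^'k^'k) \<Rightarrow> ((real^'q) \<times> (real^'l)) set" where
  "shape_domain \<Theta> V = {(\<beta>, \<gamma>). \<gamma> \<in> \<Theta> \<and> V \<gamma> \<in> PDS \<and> det (V \<gamma>) = 1}"

end

theory Submission
  imports Defs
begin

text \<open>
  The loss cannot be minimised over its whole domain by compactness, since neither the shape
  matrix nor the regression vector ranges over a bounded set. The idea is that pairs whose loss
  does not exceed that of the initial estimator are essentially confined to a compact set.
  
  The inequality between the normalised loss functions turns the scale equation
  \<open>mean \<rho>0 = b0\<close> into \<open>mean \<rho>1 \<le> r0 * sup \<rho>1\<close> at the initial estimator. Since \<open>\<rho>1\<close> is saturated
  beyond some \<open>c\<close>, any pair \<open>(\<beta>, A)\<close> doing at least as well has Mahalanobis residual at most \<open>c * \<sigma>\<close>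
  at no fewer than \<open>n * (1 - r0)\<close> points (\<open>mean_loss_small_imp_many_fit\<close>). That exceeds the number of
  points on any hyperplane, so these well fitted points affinely span \<open>UNIV \<times> (affine hull \<X>)\<close>
  (\<open>affine_hull_eq_or_hyperplane_in\<close>).
  
  For fixed spanning points this bounds everything that matters (\<open>bounded_fits\<close>). The residual
  \<open>y - X *v \<beta>\<close> is linear in the point \<open>(y, X)\<close>, so the points at which the quadratic form of the
  residual with matrix \<open>matrix_inv A\<close> stays bounded form a linear subspace. It contains the spanning
  points, hence all \<open>(v, 0)\<close> and all \<open>(0, X)\<close> with \<open>X\<close> in the affine hull of the designs. The points
  \<open>(v, 0)\<close> bound \<open>matrix_inv A\<close>, and then \<open>A\<close>, because the determinant is \<open>1\<close>; the points \<open>(0, X)\<close>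
  bound \<open>X *v \<beta>\<close>. There are only finitely many choices for the set of well fitted points.
  
  The vector \<open>\<beta>\<close> itself may stay unbounded, because the designs can have a common kernel. The loss
  does not see that kernel, so \<open>\<beta>\<close> is taken in its orthogonal complement, where the values
  \<open>X *v \<beta>\<close> at the observed designs control the norm. A continuous loss then attains its minimum
  (\<open>mean_loss_attains_minimum\<close>); the limit matrix is again some \<open>V \<gamma>\<close> because the range of \<open>V\<close> is
  closed in the positive definite matrices. Scaling and identifiability of \<open>V\<close> give the last claim.
\<close>

section \<open>Positive definite matrices and their inverses\<close>

lemma matrix_inv_mult:
  fixes A :: "real^'n^'n"
  assumes "det A \<noteq> 0"
  shows "A ** matrix_inv A = mat 1" "matrix_inv A ** A = mat 1"
proof -
  from assms have "\<exists>B. A ** B = mat 1 \<and> B ** A = mat 1"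
    by (simp add: invertible_det_nz[symmetric] invertible_def)
  then have "A ** matrix_inv A = mat 1 \<and> matrix_inv A ** A = mat 1"
    unfolding matrix_inv_def by (rule someI_ex)
  then show "A ** matrix_inv A = mat 1" "matrix_inv A ** A = mat 1" by auto
qed

lemma det_matrix_inv:
  fixes A :: "real^'n^'n"
  assumes "det A \<noteq> 0"
  shows "det (matrix_inv A) = 1 / det A"
proof -
  have "det A * det (matrix_inv A) = 1"
    using matrix_inv_mult(1)[OF assms] by (metis det_mul det_I)
  then show ?thesis using assms by (simp add: field_simps)
qed

lemma matrix_inv_matrix_inv:
  fixes A :: "real^'n^'n"
  assumes "det A \<noteq> 0"
  shows "matrix_inv (matrix_inv A) = A"
proof -
  have "det (matrix_inv A) \<noteq> 0" using assms by (simp add: det_matrix_inv)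
  then have "matrix_inv A ** matrix_inv (matrix_inv A) = mat 1" by (rule matrix_inv_mult)
  then have "A ** (matrix_inv A ** matrix_inv (matrix_inv A)) = A" by simp
  then show ?thesis by (simp add: matrix_mul_assoc matrix_inv_mult[OF assms])
qed

lemma continuous_on_det [continuous_intros]:
  fixes f :: "'a::topological_space \<Rightarrow> real^'n^'n"
  assumes "continuous_on S f"
  shows "continuous_on S (\<lambda>x. det (f x))"
  unfolding det_def using assms by (intro continuous_intros)

lemma matrix_inv_cramer:
  fixes A :: "real^'n^'n"
  assumes "det A \<noteq> 0"
  shows "matrix_inv A =
    (\<chi> k l. det (\<chi> i j. if j = k then axis l 1 $ i else A$i$j) / det A)"
proof -
  have "matrix_inv A $ k $ l = det (\<chi> i j. if j = k then axis l 1 $ i else A$i$j) / det A"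
    for k l
  proof -
    have "A *v (matrix_inv A *v axis l 1) = axis l 1"
      by (simp add: matrix_vector_mul_assoc matrix_inv_mult[OF assms])
    then have "matrix_inv A *v axis l 1 =
        (\<chi> k. det (\<chi> i j. if j = k then axis l 1 $ i else A$i$j) / det A)"
      using cramer[OF assms] by blast
    moreover have "(matrix_inv A *v axis l 1) $ k = matrix_inv A $ k $ l"
      by (simp add: matrix_vector_mul_component inner_axis)
    ultimately show ?thesis by simp
  qed
  then show ?thesis by (simp add: vec_eq_iff)
qed

text \<open>
  Cramer's rule writes each entry of the inverse as a quotient of determinants, which are
  polynomials in the entries.
\<close>

lemma continuous_on_matrix_inv:
  "continuous_on {A :: real^'n^'n. det A \<noteq> 0} matrix_inv"
proof -
  have "continuous_on {A :: real^'n^'n. det A \<noteq> 0} 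
    (\<lambda>A. \<chi> k l. det (\<chi> i j. if j = k then axis l 1 $ i else A$i$j) / det A)"
  proof (intro continuous_intros)
    fix i j k l :: 'n
    show "continuous_on {A :: real^'n^'n. det A \<noteq> 0}
      (\<lambda>A. if j = k then axis l 1 $ i else A$i$j)"
      by (cases "j = k") (auto intro!: continuous_intros)
  qed auto
  then show ?thesis
    by (rule continuous_on_eq) (simp add: matrix_inv_cramer)
qed

lemma continuous_on_matrix_vector_mult [continuous_intros]:
  fixes f :: "'a::topological_space \<Rightarrow> real^'n^'m" and g :: "'a \<Rightarrow> real^'n"
  assumes "continuous_on S f" "continuous_on S g"
  shows "continuous_on S (\<lambda>x. f x *v g x)"
  unfolding matrix_vector_mult_def using assms by (intro continuous_intros)

lemma inner_symmetric_matrix: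
  fixes A :: "real^'n^'n"
  assumes "transpose A = A"
  shows "x \<bullet> (A *v y) = y \<bullet> (A *v x)"
  by (metis assms dot_lmul_matrix inner_commute transpose_matrix_vector)

lemma quadratic_form_parallelogram:
  fixes A :: "real^'n^'n"
  shows "(x + y) \<bullet> (A *v (x + y)) + (x - y) \<bullet> (A *v (x - y))
    = 2 * (x \<bullet> (A *v x)) + 2 * (y \<bullet> (A *v y))"
  by (simp add: algebra_simps inner_simps)

lemma PDS_det_nonzero:
  assumes "A \<in> PDS"
  shows "det A \<noteq> 0"
proof -
  have "x = 0" if "A *v x = 0" for x
    using assms that unfolding PDS_def by force
  then have "invertible A"
    by (metis invertible_left_inverse matrix_left_invertible_ker)
  then show ?thesis by (simp add: invertible_det_nz)
qed

text \<open>
  The segment from the identity to \<open>A\<close> stays in the positive definite matrices, where the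
  determinant does not vanish, so the determinant keeps the sign it has at the identity.
\<close>

lemma PDS_det_pos:
  fixes A :: "real^'n^'n"
  assumes "A \<in> PDS"
  shows "0 < det A"
proof (rule ccontr)
  assume "\<not> 0 < det A"
  define f :: "real \<Rightarrow> real^'n^'n" where "f t = (1 - t) *\<^sub>R mat 1 + t *\<^sub>R A" for t
  have "continuous_on {0..1} (\<lambda>t. det (f t))"
    unfolding f_def by (intro continuous_intros)
  moreover have "det (f 1) \<le> 0" "0 \<le> det (f 0)"
    using \<open>\<not> 0 < det A\<close> by (simp_all add: f_def)
  ultimately obtain t where t: "0 \<le> t" "t \<le> 1" "det (f t) = 0"
    using IVT2'[of "\<lambda>t. det (f t)" 1 0 0] by auto
  have "f t \<in> PDS"
  proof -
    have "transpose (f t) = f t"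
    proof -
      have "A $ j $ i = A $ i $ j" for i j
        using assms by (auto simp: PDS_def transpose_def vec_eq_iff)
      then show ?thesis by (auto simp: f_def transpose_def vec_eq_iff mat_def)
    qed
    moreover have "0 < x \<bullet> (f t *v x)" if "x \<noteq> 0" for x
    proof -
      have "x \<bullet> (f t *v x) = (1 - t) * (x \<bullet> x) + t * (x \<bullet> (A *v x))"
        by (simp add: f_def matrix_vector_mult_add_rdistrib scaleR_matrix_vector_assoc[symmetric]
            inner_simps)
      moreover have "0 < x \<bullet> x" "0 < x \<bullet> (A *v x)"
        using that assms by (auto simp: PDS_def)
      ultimately show ?thesis
        using t by (cases "t = 0") (auto intro!: add_nonneg_pos)
    qed
    ultimately show ?thesis by (auto simp: PDS_def)
  qed
  then show False using t PDS_det_nonzero by blast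
qed

lemma matrix_inv_PDS:
  assumes "A \<in> PDS"
  shows "matrix_inv A \<in> PDS"
proof -
  have nz: "det A \<noteq> 0" using assms by (rule PDS_det_nonzero)
  have sym: "transpose A = A" and pos: "\<And>x. x \<noteq> 0 \<Longrightarrow> 0 < x \<bullet> (A *v x)"
    using assms by (auto simp: PDS_def)
  have inv: "A *v (matrix_inv A *v x) = x" for x
    by (simp add: matrix_vector_mul_assoc matrix_inv_mult[OF nz])
  have "transpose (matrix_inv A) ** A = mat 1"
    by (metis matrix_inv_mult(1)[OF nz] matrix_transpose_mul sym transpose_mat)
  then have "transpose (matrix_inv A) = matrix_inv A"
    by (metis matrix_inv_mult(1)[OF nz] matrix_mul_assoc matrix_mul_lid matrix_mul_rid)
  moreover have "0 < x \<bullet> (matrix_inv A *v x)" if "x \<noteq> 0" for x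
  proof -
    have "matrix_inv A *v x \<noteq> 0" using inv[of x] that by auto
    from pos[OF this] show ?thesis by (simp add: inv inner_commute)
  qed
  ultimately show ?thesis by (auto simp: PDS_def)
qed

text \<open>
  If the form of a semidefinite \<open>A\<close> vanishes at \<open>x\<close>, then \<open>x\<close> minimises the form, so the derivative
  there in the direction \<open>A *v x\<close> is zero. This forces \<open>A *v x = 0\<close>, and \<open>x = 0\<close> by invertibility.
\<close>

lemma semidefinite_imp_PDS:
  fixes A :: "real^'n^'n"
  assumes sym: "transpose A = A" and psd: "\<And>x. 0 \<le> x \<bullet> (A *v x)" and nz: "det A \<noteq> 0"
  shows "A \<in> PDS"
proof -
  have "x = 0" if x: "x \<bullet> (A *v x) = 0" for x
  proof -
    define z where "z = A *v x"
    have expand: "0 \<le> 2 * t * (z \<bullet> z) + t\<^sup>2 * (z \<bullet> (A *v z))" for t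
    proof -
      have "(x + t *\<^sub>R z) \<bullet> (A *v (x + t *\<^sub>R z)) = 2 * t * (z \<bullet> z) + t\<^sup>2 * (z \<bullet> (A *v z))"
        using x inner_symmetric_matrix[OF sym, of x z]
        by (simp add: matrix_vector_right_distrib matrix_vector_mult_scaleR inner_simps
            power2_eq_square flip: z_def) (simp add: algebra_simps)
      then show ?thesis using psd[of "x + t *\<^sub>R z"] by simp
    qed
    define q where "q = z \<bullet> (A *v z)"
    have q: "0 \<le> q" unfolding q_def by (rule psd)
    have "z \<bullet> z \<le> 0"
    proof (rule ccontr)
      assume "\<not> z \<bullet> z \<le> 0"
      then have zz: "0 < z \<bullet> z" by linarith
      \<comment> \<open>A small negative step along \<open>z\<close>: the linear term then outweighs the quadratic one.\<close>
      define t where "t = - (z \<bullet> z) / (q + 1)"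
      have "t < 0" using zz q by (simp add: t_def divide_neg_pos)
      have "0 \<le> t * (2 * (z \<bullet> z) + t * q)"
        using expand[of t] by (simp add: q_def power2_eq_square algebra_simps)
      then have "2 * (z \<bullet> z) + t * q \<le> 0"
        using \<open>t < 0\<close> by (simp add: zero_le_mult_iff)
      moreover have "t * q \<ge> - (z \<bullet> z)"
        using zz q by (simp add: t_def field_simps)
      ultimately show False using zz by simp
    qed
    then have "z = 0" by (metis inner_eq_zero_iff inner_ge_zero order_antisym)
    then have "A *v x = 0" by (simp add: z_def)
    then have "matrix_inv A *v (A *v x) = 0" by simp
    then show "x = 0" by (simp add: matrix_vector_mul_assoc matrix_inv_mult[OF nz])
  qed
  then show ?thesis using sym psd unfolding PDS_def by (auto simp: order_less_le) 
qed

text \<open>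
  The positive definite matrices alone are not closed, but on the level set \<open>det A = 1\<close> a
  semidefinite limit is invertible and hence definite.
\<close>

lemma closed_PDS_det_1: "closed {A :: real^'n^'n. A \<in> PDS \<and> det A = 1}"
proof -
  have "{A :: real^'n^'n. A \<in> PDS \<and> det A = 1}
    = {A. transpose A = A} \<inter> (\<Inter>x. {A. 0 \<le> x \<bullet> (A *v x)}) \<inter> {A. det A = 1}"
  proof (intro subset_antisym subsetI)
    fix A :: "real^'n^'n" assume "A \<in> {A. A \<in> PDS \<and> det A = 1}"
    then have "transpose A = A" "det A = 1" and pos: "\<And>x. x \<noteq> 0 \<Longrightarrow> 0 < x \<bullet> (A *v x)"
      by (auto simp: PDS_def)
    moreover have "0 \<le> x \<bullet> (A *v x)" for x
      using pos[of x] by (cases "x = 0") auto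
    ultimately show "A \<in> {A. transpose A = A} \<inter> (\<Inter>x. {A. 0 \<le> x \<bullet> (A *v x)}) \<inter> {A. det A = 1}"
      by auto
  qed (simp add: semidefinite_imp_PDS)
  moreover have "closed {A :: real^'n^'n. transpose A = A}"
    unfolding transpose_def by (intro closed_Collect_eq continuous_intros)
  moreover have "closed {A :: real^'n^'n. 0 \<le> x \<bullet> (A *v x)}" for x
    by (intro closed_Collect_le continuous_intros)
  moreover have "closed {A :: real^'n^'n. det A = 1}"
    by (intro closed_Collect_eq continuous_intros)
  ultimately show ?thesis by (simp add: closed_INT closed_Int)
qed

lemma det_scaleR:
  fixes A :: "real^'n^'n"
  shows "det (c *\<^sub>R A) = c ^ CARD('n) * det A"
  by (simp add: det_def prod.distrib sum_distrib_left mult_ac)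

lemma det_shape:
  fixes A :: "real^'n::finite^'n"
  assumes "A \<in> PDS"
  shows "det (shape A) = 1"
proof -
  have pos: "0 < det A" using assms by (rule PDS_det_pos)
  have "(det A powr (1 / real CARD('n))) ^ CARD('n) = det A"
    using pos by (simp add: powr_realpow[symmetric] powr_powr)
  then show ?thesis
    using pos by (simp add: shape_def det_scaleR power_divide)
qed

text \<open>
  The form is positive on the compact set \<open>K \<times> sphere 0 1\<close>, and its minimum there serves as \<open>m\<close>.
\<close>

lemma uniformly_coercive:
  fixes K :: "(real^'n^'n) set"
  assumes "compact K" "K \<subseteq> PDS"
  shows "\<exists>m>0. \<forall>A\<in>K. \<forall>x. m * (norm x)\<^sup>2 \<le> x \<bullet> (A *v x)"
proof (cases "K \<times> sphere (0::real^'n) 1 = {}")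
  case True
  have "sphere (0::real^'n) 1 \<noteq> {}" by simp
  with True have "K = {}" by auto
  then show ?thesis by (auto intro: exI[of _ 1])
next
  case False
  have "compact (K \<times> sphere (0::real^'n) 1)"
    using assms by (intro compact_Times) auto
  moreover have "continuous_on (K \<times> sphere (0::real^'n) 1) (\<lambda>p. snd p \<bullet> (fst p *v snd p))"
    by (intro continuous_intros)
  ultimately obtain p where p: "p \<in> K \<times> sphere 0 1"
    and min: "\<And>r. r \<in> K \<times> sphere 0 1 \<Longrightarrow> snd p \<bullet> (fst p *v snd p) \<le> snd r \<bullet> (fst r *v snd r)"
    using continuous_attains_inf[OF _ False] by blast
  define m where "m = snd p \<bullet> (fst p *v snd p)"
  have "fst p \<in> PDS" "snd p \<noteq> 0" using p assms by (auto simp: mem_Times_iff)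
  then have "0 < m" by (auto simp: m_def PDS_def)
  moreover have "m * (norm x)\<^sup>2 \<le> x \<bullet> (A *v x)" if "A \<in> K" for A x
  proof (cases "x = 0")
    case False
    define u where "u = (1 / norm x) *\<^sub>R x"
    have x: "x = norm x *\<^sub>R u" using False by (simp add: u_def)
    have "(A, u) \<in> K \<times> sphere 0 1" using that False by (simp add: u_def)
    from min[OF this] have "m \<le> u \<bullet> (A *v u)" by (simp add: m_def)
    then have "m * (norm x)\<^sup>2 \<le> (u \<bullet> (A *v u)) * (norm x)\<^sup>2" by (simp add: mult_right_mono)
    also have "\<dots> = x \<bullet> (A *v x)"
    proof -
      have "x \<bullet> (A *v x) = (norm x *\<^sub>R u) \<bullet> (A *v (norm x *\<^sub>R u))"
        using x by metis
      then show ?thesis by (simp add: matrix_vector_mult_scaleR power2_eq_square)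
    qed
    finally show ?thesis .
  qed simp
  ultimately show ?thesis by blast
qed

section \<open>Points that lie on no common hyperplane\<close>

text \<open>
  Adjoining one point of \<open>T\<close> at a time to \<open>S\<close> raises the dimension by one at each step, so
  codimension one is reached on the way.
\<close>

lemma affine_subset_hyperplane:
  fixes S T :: "'a::euclidean_space set"
  assumes "affine S" "affine T" "S \<subset> T"
  shows "\<exists>H. affine H \<and> S \<subseteq> H \<and> H \<subseteq> T \<and> aff_dim H = aff_dim T - 1"
  using assms(1,3)
proof (induction "nat (aff_dim T - aff_dim S)" arbitrary: S rule: less_induct)
  case less
  have lt: "aff_dim S < aff_dim T"
    using less.prems \<open>affine T\<close> by (intro aff_dim_psubset) (simp add: hull_same)
  show ?case
  proof (cases "aff_dim S = aff_dim T - 1")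
    case True
    then show ?thesis using less.prems by blast
  next
    case False
    obtain a where a: "a \<in> T" "a \<notin> S" using less.prems by auto
    define S' where "S' = affine hull (insert a S)"
    have dim: "aff_dim S' = aff_dim S + 1"
      using a less.prems by (simp add: S'_def aff_dim_insert hull_same)
    have "S' \<subseteq> T"
      unfolding S'_def using a less.prems \<open>affine T\<close> by (intro hull_minimal) auto
    moreover have "S' \<noteq> T" using dim False by auto
    ultimately have "S' \<subset> T" by auto
    moreover have "nat (aff_dim T - aff_dim S') < nat (aff_dim T - aff_dim S)"
      using dim lt by simp
    moreover have "affine S'" by (simp add: S'_def)
    ultimately have "\<exists>H. affine H \<and> S' \<subseteq> H \<and> H \<subseteq> T \<and> aff_dim H = aff_dim T - 1"
      by (intro less.hyps)
    then obtain H where "affine H" "S' \<subseteq> H" "H \<subseteq> T" "aff_dim H = aff_dim T - 1"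
      by auto
    moreover have "S \<subseteq> S'" unfolding S'_def by (meson hull_subset insert_subset)
    ultimately show ?thesis by blast
  qed
qed

lemma aff_dim_UNIV_Times:
  fixes L :: "'b::euclidean_space set"
  assumes "affine L" "L \<noteq> {}"
  shows "aff_dim ((UNIV :: 'a::euclidean_space set) \<times> L) = int (DIM('a)) + aff_dim L"
proof -
  obtain a where a: "a \<in> L" using assms by auto
  define U where "U = (+) (-a) ` L"
  have U: "subspace U"
    unfolding U_def using assms a affine_diffs_subspace by blast
  have "UNIV \<times> L = (+) (0::'a, a) ` (UNIV \<times> U)"
  proof (intro subset_antisym subsetI)
    fix p :: "'a \<times> 'b" assume "p \<in> UNIV \<times> L"
    then have "p = (0, a) + (fst p, - a + snd p)" "(fst p, - a + snd p) \<in> UNIV \<times> U"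
      by (auto simp: U_def)
    then show "p \<in> (+) (0, a) ` (UNIV \<times> U)" by (rule image_eqI)
  qed (auto simp: U_def)
  moreover have "subspace (UNIV \<times> U :: ('a \<times> 'b) set)"
    using U by (intro subspace_Times) auto
  moreover have "aff_dim L = int (dim U)"
    using U by (metis U_def aff_dim_subspace aff_dim_translation_eq)
  ultimately show ?thesis
    using U by (simp add: aff_dim_translation_eq aff_dim_subspace dim_Times)
qed

lemma affine_UNIV_Times: "affine L \<Longrightarrow> affine (UNIV \<times> L)"
  by (auto simp: affine_def)

text \<open>
  This is how the counting hypothesis on hyperplanes is used: a collection with more than
  \<open>kappa \<X> n s\<close> points falls under the first alternative.
\<close>

lemma affine_hull_eq_or_hyperplane_in:
  fixes S :: "('k::finite, 'q::finite) point set"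
  assumes sub: "S \<subseteq> UNIV \<times> (affine hull \<X>)" and ne: "\<X> \<noteq> {}"
  shows "affine hull S = UNIV \<times> (affine hull \<X>) \<or> (\<exists>H. hyperplane_in \<X> H \<and> S \<subseteq> H)"
proof (rule disjCI)
  assume no: "\<not> (\<exists>H. hyperplane_in \<X> H \<and> S \<subseteq> H)"
  let ?T = "UNIV \<times> (affine hull \<X>) :: ('k, 'q) point set"
  have aff: "affine ?T" by (simp add: affine_UNIV_Times)
  then have "affine hull S \<subseteq> ?T" using sub by (simp add: hull_minimal)
  moreover have "\<not> affine hull S \<subset> ?T"
  proof
    assume "affine hull S \<subset> ?T"
    from affine_subset_hyperplane[OF affine_affine_hull aff this] obtain H
      where H: "affine H" "affine hull S \<subseteq> H" "H \<subseteq> ?T" "aff_dim H = aff_dim ?T - 1"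
      by auto
    have "aff_dim ?T = int CARD('k) + aff_dim \<X>"
      using ne by (simp add: aff_dim_UNIV_Times)
    then have "hyperplane_in \<X> H" using H by (simp add: hyperplane_in_def)
    then show False using no H hull_subset[of S affine] by blast
  qed
  ultimately show "affine hull S = ?T" by auto
qed

lemma card_le_kappa:
  assumes "hyperplane_in \<X> H" "J \<subseteq> {1..n}" "s ` J \<subseteq> H"
  shows "card J \<le> kappa \<X> n s"
proof -
  let ?N = "{card {i \<in> {1..n}. s i \<in> H} |H. hyperplane_in \<X> H}"
  have "card J \<le> card {i \<in> {1..n}. s i \<in> H}"
    using assms by (intro card_mono) auto
  also have "\<dots> \<le> Max ?N"
  proof (rule Max_ge)
    have "card {i \<in> {1..n}. s i \<in> H'} \<le> n" for H'
    proof -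
      have "card {i \<in> {1..n}. s i \<in> H'} \<le> card {1..n}"
        by (intro card_mono) auto
      then show ?thesis by simp
    qed
    then have "?N \<subseteq> {..n}" by auto
    then show "finite ?N" using finite_subset by blast
    show "card {i \<in> {1..n}. s i \<in> H} \<in> ?N" using assms by blast
  qed
  finally show ?thesis by (simp add: kappa_def)
qed

section \<open>Pairs that fit a spanning set of points\<close>

definition residual_form :: "real^'k^'k \<Rightarrow> real^'q \<Rightarrow> ('k::finite, 'q::finite) point \<Rightarrow> real" where
  "residual_form B \<beta> p = (fst p - snd p *v \<beta>) \<bullet> (B *v (fst p - snd p *v \<beta>))"

lemma mahalanobis_eq_sqrt: "mahalanobis A \<beta> p = sqrt (residual_form (matrix_inv A) \<beta> p)"
  by (simp add: mahalanobis_def residual_form_def)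

lemma residual_form_nonneg: "B \<in> PDS \<Longrightarrow> 0 \<le> residual_form B \<beta> p"
  unfolding residual_form_def PDS_def
  by (cases "fst p - snd p *v \<beta> = 0") (auto simp: less_imp_le)

text \<open>
  A substitute for the triangle inequality of the norm induced by \<open>B\<close> that avoids a square root
  of \<open>B\<close>: the parallelogram law with the difference term dropped.
\<close>

lemma residual_form_add_le:
  assumes "B \<in> PDS"
  shows "residual_form B \<beta> (p + r) \<le> 2 * residual_form B \<beta> p + 2 * residual_form B \<beta> r"
proof -
  have plus: "fst (p + r) - snd (p + r) *v \<beta> = (fst p - snd p *v \<beta>) + (fst r - snd r *v \<beta>)"
    by (simp add: matrix_vector_mult_add_rdistrib)
  have minus: "fst (p - r) - snd (p - r) *v \<beta> = (fst p - snd p *v \<beta>) - (fst r - snd r *v \<beta>)"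
    by (simp add: matrix_vector_mult_diff_rdistrib)
  have "residual_form B \<beta> (p + r) + residual_form B \<beta> (p - r)
      = 2 * residual_form B \<beta> p + 2 * residual_form B \<beta> r"
    unfolding residual_form_def plus minus by (rule quadratic_form_parallelogram)
  then show ?thesis using residual_form_nonneg[OF assms, of \<beta> "p - r"] by linarith
qed

lemma residual_form_scaleR: "residual_form B \<beta> (c *\<^sub>R p) = c\<^sup>2 * residual_form B \<beta> p"
proof -
  have "fst (c *\<^sub>R p) - snd (c *\<^sub>R p) *v \<beta> = c *\<^sub>R (fst p - snd p *v \<beta>)"
    by (simp add: scaleR_matrix_vector_assoc[symmetric] scaleR_right_diff_distrib)
  then show ?thesis
    by (simp add: residual_form_def matrix_vector_mult_scaleR power2_eq_square)
qed

text \<open>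
  The residual depends linearly on the point, so boundedness of the form over \<open>F\<close> is inherited by
  sums and multiples of points. The bound may depend on the point.
\<close>

lemma residual_form_bounded_on_span:
  fixes F :: "((real^'q) \<times> (real^'k^'k)) set"
  assumes F: "\<And>\<beta> B. (\<beta>, B) \<in> F \<Longrightarrow> B \<in> PDS"
    and S: "\<And>p. p \<in> S \<Longrightarrow> \<exists>C. \<forall>(\<beta>, B)\<in>F. residual_form B \<beta> p \<le> C"
    and t: "t \<in> span S"
  shows "\<exists>C. \<forall>(\<beta>, B)\<in>F. residual_form B \<beta> t \<le> C"
proof -
  define G where "G = {t. \<exists>C. \<forall>(\<beta>, B)\<in>F. residual_form B \<beta> t \<le> C}"
  have "subspace G"
  proof (rule subspaceI)
    show "0 \<in> G"
      by (auto simp: G_def residual_form_def intro!: exI[of _ 0])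
  next
    fix p r assume "p \<in> G" "r \<in> G"
    then obtain C D where CD: "\<And>\<beta> B. (\<beta>, B) \<in> F \<Longrightarrow> residual_form B \<beta> p \<le> C"
      "\<And>\<beta> B. (\<beta>, B) \<in> F \<Longrightarrow> residual_form B \<beta> r \<le> D"
      by (fastforce simp: G_def)
    have "residual_form B \<beta> (p + r) \<le> 2 * C + 2 * D" if "(\<beta>, B) \<in> F" for \<beta> B
      using residual_form_add_le[OF F[OF that], of \<beta> p r] CD[OF that] by linarith
    then show "p + r \<in> G" by (auto simp: G_def)
  next
    fix c p assume "p \<in> G"
    then obtain C where C: "\<And>\<beta> B. (\<beta>, B) \<in> F \<Longrightarrow> residual_form B \<beta> p \<le> C"
      by (fastforce simp: G_def)
    have "residual_form B \<beta> (c *\<^sub>R p) \<le> c\<^sup>2 * C" if "(\<beta>, B) \<in> F" for \<beta> B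
      using C[OF that] by (simp add: residual_form_scaleR mult_left_mono)
    then show "c *\<^sub>R p \<in> G" by (auto simp: G_def)
  qed
  moreover have "S \<subseteq> G" using S by (auto simp: G_def)
  ultimately have "span S \<subseteq> G" by (simp add: span_minimal)
  then show ?thesis using t by (auto simp: G_def)
qed

lemma norm_matrix_le_sum:
  fixes B :: "real^'n^'m"
  shows "norm B \<le> (\<Sum>i\<in>UNIV. \<Sum>j\<in>UNIV. \<bar>B$i$j\<bar>)"
proof -
  have "norm B \<le> (\<Sum>i\<in>UNIV. norm (B$i))"
    unfolding norm_vec_def[of B] by (rule L2_set_le_sum) (rule norm_ge_zero)
  also have "\<dots> \<le> (\<Sum>i\<in>UNIV. \<Sum>j\<in>UNIV. \<bar>B$i$j\<bar>)"
    by (intro sum_mono norm_le_l1_cart)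
  finally show ?thesis .
qed

text \<open>
  The two bounds on \<open>B$i$j\<close> are the nonnegativity of the form at \<open>axis i 1 + axis j 1\<close> and at
  \<open>axis i 1 - axis j 1\<close>.
\<close>

lemma PDS_entry_le:
  fixes B :: "real^'n^'n"
  assumes "B \<in> PDS"
  shows "2 * \<bar>B$i$j\<bar> \<le> axis i 1 \<bullet> (B *v axis i 1) + axis j 1 \<bullet> (B *v axis j 1)"
proof -
  let ?x = "axis i 1 :: real^'n" and ?y = "axis j 1 :: real^'n"
  have nonneg: "0 \<le> z \<bullet> (B *v z)" for z
    using assms by (cases "z = 0") (auto simp: PDS_def less_imp_le)
  have entry: "?x \<bullet> (B *v ?y) = B$i$j"
    by (simp add: inner_axis' matrix_vector_mul_component inner_axis)
  have "?y \<bullet> (B *v ?x) = B$i$j"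
    using assms entry inner_symmetric_matrix[of B ?x ?y] by (simp add: PDS_def)
  then show ?thesis
    using nonneg[of "?x + ?y"] nonneg[of "?x - ?y"] entry
    by (simp add: matrix_vector_right_distrib matrix_vector_mult_diff_distrib inner_simps abs_le_iff)
qed

text \<open>
  The key estimate. Every point of \<open>UNIV \<times> L\<close> lies in the span of \<open>S\<close>, so the residual form is
  bounded at it. Differences of points \<open>(v, X0)\<close> and \<open>(0, X0)\<close> isolate the form of \<open>matrix_inv A\<close> at
  \<open>v\<close>, and the point \<open>(0, X)\<close> isolates its value at \<open>X *v \<beta>\<close>.
\<close>

lemma bounded_fits:
  fixes S :: "('k::finite, 'q::finite) point set" and c :: real
  assumes S: "affine hull S = UNIV \<times> L" and L: "L \<noteq> {}"
  defines "F \<equiv> {(\<beta>, A). A \<in> PDS \<and> det A = 1 \<and> (\<forall>p\<in>S. mahalanobis A \<beta> p \<le> c)}"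
  shows "\<exists>K. compact K \<and> (\<forall>(\<beta>, A)\<in>F. A \<in> K)"
    and "X \<in> L \<Longrightarrow> \<exists>C. \<forall>(\<beta>, A)\<in>F. norm (X *v \<beta>) \<le> C"
proof -
  \<comment> \<open>The estimates concern the inverses, so the pairs are rewritten in terms of them.\<close>
  define F' where "F' = (\<lambda>(\<beta>, A). (\<beta>, matrix_inv A)) ` F"
  have F'_PDS: "B \<in> PDS" "det B = 1" if "(\<beta>, B) \<in> F'" for \<beta> B
    using that by (auto simp: F'_def F_def matrix_inv_PDS det_matrix_inv)
  have "residual_form B \<beta> p \<le> c\<^sup>2" if "(\<beta>, B) \<in> F'" "p \<in> S" for \<beta> B p
  proof -
    have "sqrt (residual_form B \<beta> p) \<le> c"
      using that by (auto simp: F'_def F_def mahalanobis_eq_sqrt)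
    then show ?thesis by (rule sqrt_le_D)
  qed
  then have "\<exists>C. \<forall>(\<beta>, B)\<in>F'. residual_form B \<beta> p \<le> C" if "p \<in> S" for p
    using that by blast
  then have span: "\<exists>C. \<forall>(\<beta>, B)\<in>F'. residual_form B \<beta> t \<le> C" if "t \<in> span S" for t
    using that F'_PDS(1) residual_form_bounded_on_span by blast
  have T: "UNIV \<times> L \<subseteq> span S"
    using affine_hull_subset_span[of S] S by simp
  obtain X0 where X0: "X0 \<in> L" using L by auto
  have "\<exists>C. \<forall>(\<beta>, B)\<in>F'. v \<bullet> (B *v v) \<le> C" for v :: "real^'k"
  proof -
    have "(v, X0) - (0, X0) \<in> span S"
      using T X0 by (intro span_diff) auto
    then have "(v, 0) \<in> span S" by simp
    from span[OF this] show ?thesis by (simp add: residual_form_def)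
  qed
  then have "\<exists>C. \<forall>(\<beta>, B)\<in>F'. axis i 1 \<bullet> (B *v axis i 1) \<le> C" for i :: 'k
    by blast
  then obtain D where D: "\<And>i \<beta> B. (\<beta>, B) \<in> F' \<Longrightarrow> axis i 1 \<bullet> (B *v axis i 1) \<le> D i"
    by (metis (mono_tags, lifting) case_prodD)
  define M where "M = (\<Sum>i\<in>UNIV. \<Sum>j\<in>UNIV. (D i + D j) / 2)"
  define K where "K = {B :: real^'k^'k. B \<in> PDS \<and> det B = 1} \<inter> cball 0 M"
  have "B \<in> K" if "(\<beta>, B) \<in> F'" for \<beta> B
  proof -
    have "\<bar>B$i$j\<bar> \<le> (D i + D j) / 2" for i j
      using PDS_entry_le[OF F'_PDS(1)[OF that], of i j] D[OF that, of i] D[OF that, of j] by simp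
    then have "norm B \<le> M"
      unfolding M_def by (intro order_trans[OF norm_matrix_le_sum] sum_mono)
    then show ?thesis using F'_PDS[OF that] by (simp add: K_def)
  qed
  then have F_K: "matrix_inv A \<in> K" if "(\<beta>, A) \<in> F" for \<beta> A
    using that by (force simp: F'_def)
  have K: "compact K" "K \<subseteq> PDS"
    unfolding K_def using closed_PDS_det_1 by (auto intro: closed_Int_compact)
  show "\<exists>K. compact K \<and> (\<forall>(\<beta>, A)\<in>F. A \<in> K)"
  proof (intro exI[of _ "matrix_inv ` K"] conjI)
    have "continuous_on K matrix_inv"
      by (rule continuous_on_subset[OF continuous_on_matrix_inv]) (auto simp: K_def)
    then show "compact (matrix_inv ` K)" using K by (simp add: compact_continuous_image)
    have "A \<in> matrix_inv ` K" if "(\<beta>, A) \<in> F" for \<beta> A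
    proof (rule image_eqI)
      show "A = matrix_inv (matrix_inv A)"
        using that by (simp add: F_def matrix_inv_matrix_inv)
    qed (rule F_K[OF that])
    then show "\<forall>(\<beta>, A)\<in>F. A \<in> matrix_inv ` K" by blast
  qed
  show "\<exists>C. \<forall>(\<beta>, A)\<in>F. norm (X *v \<beta>) \<le> C" if "X \<in> L"
  proof -
    \<comment> \<open>The matrices in \<open>K\<close> are uniformly definite, so a bounded form means a bounded vector.\<close>
    obtain m where m: "m > 0" "\<And>B x. B \<in> K \<Longrightarrow> m * (norm x)\<^sup>2 \<le> x \<bullet> (B *v x)"
      using uniformly_coercive[OF K] by blast
    have "(0, X) \<in> span S" using T that by auto
    from span[OF this] obtain C
      where C: "\<And>\<beta> B. (\<beta>, B) \<in> F' \<Longrightarrow> residual_form B \<beta> (0, X) \<le> C" by fastforce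
    have "norm (X *v \<beta>) \<le> sqrt (C / m)" if "(\<beta>, A) \<in> F" for \<beta> A
    proof -
      have "(\<beta>, matrix_inv A) \<in> F'" using that by (force simp: F'_def)
      then have "m * (norm (- (X *v \<beta>)))\<^sup>2 \<le> C"
        using C m(2)[OF F_K[OF that], of "- (X *v \<beta>)"]
        by (fastforce simp: residual_form_def)
      then have "(norm (X *v \<beta>))\<^sup>2 \<le> C / m"
        using m(1) by (simp add: field_simps)
      then show ?thesis by (rule real_le_rsqrt)
    qed
    then show ?thesis by blast
  qed
qed

section \<open>Existence of a minimiser\<close>

text \<open>
  Away from the common kernel the sum is positive, so its minimum over the unit sphere of the
  orthogonal complement serves as \<open>e\<close>.
\<close>

lemma coercive_on_orthogonal_comp_kernel:
  fixes X :: "'i \<Rightarrow> real^'q^'k"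
  assumes "finite I"
  shows "\<exists>e>0. \<forall>\<beta>\<in>{\<beta>. \<forall>i\<in>I. X i *v \<beta> = 0}\<^sup>\<bottom>. e * norm \<beta> \<le> (\<Sum>i\<in>I. norm (X i *v \<beta>))"
proof -
  define N where "N = {\<beta>. \<forall>i\<in>I. X i *v \<beta> = 0}"
  define f where "f \<beta> = (\<Sum>i\<in>I. norm (X i *v \<beta>))" for \<beta>
  have "\<exists>e>0. \<forall>\<beta>\<in>N\<^sup>\<bottom>. e * norm \<beta> \<le> f \<beta>"
  proof (cases "N\<^sup>\<bottom> \<inter> sphere 0 1 = {}")
    case True
    have zero: "\<beta> = 0" if "\<beta> \<in> N\<^sup>\<bottom>" for \<beta>
    proof (rule ccontr)
      assume "\<beta> \<noteq> 0"
      then have "(1 / norm \<beta>) *\<^sub>R \<beta> \<in> N\<^sup>\<bottom> \<inter> sphere 0 1"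
        using that by (simp add: subspace_orthogonal_comp subspace_scale)
      then show False using True by blast
    qed
    have "1 * norm \<beta> \<le> f \<beta>" if "\<beta> \<in> N\<^sup>\<bottom>" for \<beta>
      using zero[OF that] by (simp add: f_def)
    then show ?thesis by (intro exI[of _ 1]) auto
  next
    case False
    have "compact (N\<^sup>\<bottom> \<inter> sphere 0 1)"
      by (intro closed_Int_compact closed_subspace subspace_orthogonal_comp) auto
    moreover have "continuous_on (N\<^sup>\<bottom> \<inter> sphere 0 1) f"
      unfolding f_def by (intro continuous_intros)
    ultimately obtain u where u: "u \<in> N\<^sup>\<bottom>" "norm u = 1"
      and min: "\<And>w. w \<in> N\<^sup>\<bottom> \<Longrightarrow> norm w = 1 \<Longrightarrow> f u \<le> f w"
      using continuous_attains_inf[OF _ False] by fastforce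
    have "u \<notin> N"
    proof
      assume "u \<in> N"
      then have "orthogonal u u" using u by (simp add: orthogonal_comp_def)
      then show False using u by (simp add: orthogonal_def)
    qed
    then obtain i where "i \<in> I" "X i *v u \<noteq> 0" by (auto simp: N_def)
    then have "0 < f u"
      unfolding f_def using assms by (intro sum_pos2[of _ i]) auto
    moreover have "f u * norm \<beta> \<le> f \<beta>" if "\<beta> \<in> N\<^sup>\<bottom>" for \<beta>
    proof (cases "\<beta> = 0")
      case True
      then show ?thesis by (simp add: f_def)
    next
      case False
      then have "f u \<le> f ((1 / norm \<beta>) *\<^sub>R \<beta>)"
        using that by (intro min) (simp_all add: subspace_orthogonal_comp subspace_scale)
      also have "\<dots> = f \<beta> / norm \<beta>"
        by (simp add: f_def matrix_vector_mult_scaleR sum_divide_distrib)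
      finally show ?thesis using False by (simp add: field_simps)
    qed
    ultimately show ?thesis by blast
  qed
  then show ?thesis by (simp add: N_def f_def)
qed

text \<open>
  Replacing \<open>\<beta>\<close> by its component orthogonal to the common kernel changes no residual.
\<close>

lemma ex_orthogonal_comp_kernel_same_image:
  fixes X :: "'i \<Rightarrow> real^'q^'k"
  shows "\<exists>\<beta>'\<in>{\<beta>. \<forall>i\<in>I. X i *v \<beta> = 0}\<^sup>\<bottom>. \<forall>i\<in>I. X i *v \<beta>' = X i *v \<beta>"
proof -
  define N where "N = {\<beta>. \<forall>i\<in>I. X i *v \<beta> = 0}"
  have N: "span N = N"
  proof -
    have "subspace N"
      unfolding N_def by (rule subspaceI)
        (auto simp: matrix_vector_right_distrib matrix_vector_mult_scaleR)
    then show ?thesis by simp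
  qed
  obtain y z where yz: "y \<in> span N" "\<And>w. w \<in> span N \<Longrightarrow> orthogonal z w" "\<beta> = y + z"
    using orthogonal_subspace_decomp_exists[of N \<beta>] by metis
  have "z \<in> N\<^sup>\<bottom>" using yz N by (auto simp: orthogonal_comp_def orthogonal_commute)
  moreover have "\<forall>i\<in>I. X i *v z = X i *v \<beta>"
  proof -
    have "y \<in> N" using yz(1) unfolding N .
    then show ?thesis by (simp add: yz(3) N_def matrix_vector_right_distrib)
  qed
  ultimately show ?thesis by (auto simp: N_def)
qed

lemma continuous_on_mean_loss:
  fixes s :: "nat \<Rightarrow> ('k::finite, 'q::finite) point"
  assumes \<rho>: "continuous_on UNIV \<rho>" and \<sigma>: "\<sigma> \<noteq> 0"
  shows "continuous_on (UNIV \<times> {A. det A \<noteq> 0}) (\<lambda>(\<beta>, A). mean_loss \<rho> n s \<sigma> \<beta> A)"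
proof -
  have inv: "continuous_on (UNIV \<times> {A. det A \<noteq> 0}) (\<lambda>p :: (real^'q) \<times> (real^'k^'k). matrix_inv (snd p))"
    by (rule continuous_on_compose2[OF continuous_on_matrix_inv]) (auto intro: continuous_intros)
  have "continuous_on (UNIV \<times> {A. det A \<noteq> 0}) (\<lambda>p. \<rho> (mahalanobis (snd p) (fst p) (s i) / \<sigma>))" for i
    unfolding mahalanobis_def using \<sigma>
    by (intro continuous_on_compose2[OF \<rho>] continuous_intros inv) auto
  then show ?thesis
    unfolding mean_loss_def case_prod_beta by (intro continuous_intros)
qed

text \<open>
  Pairs with loss above the reference value at \<open>(\<beta>0, A0)\<close> are irrelevant to the minimum. The others
  fit some spanning subcollection, so after moving \<open>\<beta>\<close> into the orthogonal complement of the common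
  kernel of the designs they lie in one compact set \<open>Q\<close>.
\<close>

lemma mean_loss_attains_minimum:
  fixes s :: "nat \<Rightarrow> ('k::finite, 'q::finite) point"
  assumes \<rho>: "continuous_on UNIV \<rho>" and \<sigma>: "\<sigma> \<noteq> 0"
    and \<V>: "closed \<V>" "\<V> \<subseteq> {A. A \<in> PDS \<and> det A = 1}" and A0: "A0 \<in> \<V>"
    and L: "L \<noteq> {}" "\<And>i. i \<in> {1..n} \<Longrightarrow> snd (s i) \<in> L"
    and fits: "\<And>\<beta> A. A \<in> \<V> \<Longrightarrow> mean_loss \<rho> n s \<sigma> \<beta> A \<le> mean_loss \<rho> n s \<sigma> \<beta>0 A0 \<Longrightarrow>
      \<exists>J\<subseteq>{1..n}. affine hull (s ` J) = UNIV \<times> L \<and> (\<forall>j\<in>J. mahalanobis A \<beta> (s j) \<le> c)"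
  shows "\<exists>\<beta>1. \<exists>A1\<in>\<V>. \<forall>\<beta>. \<forall>A\<in>\<V>. mean_loss \<rho> n s \<sigma> \<beta>1 A1 \<le> mean_loss \<rho> n s \<sigma> \<beta> A"
proof -
  define R where "R \<beta> A = mean_loss \<rho> n s \<sigma> \<beta> A" for \<beta> A
  define \<J> where "\<J> = {J. J \<subseteq> {1..n} \<and> affine hull (s ` J) = UNIV \<times> L}"
  define F where "F J = {(\<beta>, A). A \<in> PDS \<and> det A = 1 \<and> (\<forall>p\<in>s ` J. mahalanobis A \<beta> p \<le> c)}" for J
  have fin: "finite \<J>"
    by (rule finite_subset[of _ "Pow {1..n}"]) (auto simp: \<J>_def)
  have "\<forall>J\<in>\<J>. \<exists>K. compact K \<and> (\<forall>(\<beta>, A)\<in>F J. A \<in> K)"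
    unfolding F_def by (intro ballI bounded_fits(1)[OF _ L(1)]) (simp add: \<J>_def)
  then obtain K where K: "\<And>J. J \<in> \<J> \<Longrightarrow> compact (K J)"
    "\<And>J \<beta> A. J \<in> \<J> \<Longrightarrow> (\<beta>, A) \<in> F J \<Longrightarrow> A \<in> K J"
    by (metis (mono_tags, lifting) case_prodD)
  have "\<forall>J\<in>\<J>. \<forall>i\<in>{1..n}. \<exists>C. \<forall>(\<beta>, A)\<in>F J. norm (snd (s i) *v \<beta>) \<le> C"
    unfolding F_def by (intro ballI bounded_fits(2)[OF _ L]) (simp_all add: \<J>_def)
  then obtain C where C: "\<And>J i \<beta> A. J \<in> \<J> \<Longrightarrow> i \<in> {1..n} \<Longrightarrow> (\<beta>, A) \<in> F J \<Longrightarrow>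
      norm (snd (s i) *v \<beta>) \<le> C J i"
    by (metis (mono_tags, lifting) case_prodD)
  define E where "E = (\<Sum>J\<in>\<J>. \<bar>\<Sum>i=1..n. C J i\<bar>)"
  have E: "(\<Sum>i=1..n. norm (snd (s i) *v \<beta>)) \<le> E" if "J \<in> \<J>" "(\<beta>, A) \<in> F J" for J \<beta> A
  proof -
    have "(\<Sum>i=1..n. norm (snd (s i) *v \<beta>)) \<le> (\<Sum>i=1..n. C J i)"
      using C that by (intro sum_mono) blast
    also have "\<dots> \<le> \<bar>\<Sum>i=1..n. C J i\<bar>" by simp
    also have "\<dots> \<le> E"
      unfolding E_def using fin that by (intro member_le_sum) auto
    finally show ?thesis .
  qed
  define W where "W = {\<beta>. \<forall>i\<in>{1..n}. snd (s i) *v \<beta> = 0}\<^sup>\<bottom>"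
  obtain e where e: "e > 0"
    "\<And>\<beta>. \<beta> \<in> W \<Longrightarrow> e * norm \<beta> \<le> (\<Sum>i=1..n. norm (snd (s i) *v \<beta>))"
    unfolding W_def using coercive_on_orthogonal_comp_kernel[of "{1..n}" "\<lambda>i. snd (s i)"] by auto
  define Q where "Q = (W \<inter> cball 0 (E / e)) \<times> ((\<Union>J\<in>\<J>. K J) \<inter> \<V>)"
  have reduce: "\<exists>\<beta>'. (\<beta>', A) \<in> Q \<and> R \<beta>' A = R \<beta> A" if A: "A \<in> \<V>" and le: "R \<beta> A \<le> R \<beta>0 A0" for \<beta> A
  proof -
    obtain \<beta>' where \<beta>': "\<beta>' \<in> W" "\<And>i. i \<in> {1..n} \<Longrightarrow> snd (s i) *v \<beta>' = snd (s i) *v \<beta>"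
      unfolding W_def using ex_orthogonal_comp_kernel_same_image[of "{1..n}" "\<lambda>i. snd (s i)" \<beta>] by auto
    have R: "R \<beta>' A = R \<beta> A"
      unfolding R_def mean_loss_def mahalanobis_def using \<beta>'(2) by simp
    then have "mean_loss \<rho> n s \<sigma> \<beta>' A \<le> mean_loss \<rho> n s \<sigma> \<beta>0 A0" using le by (simp add: R_def)
    from fits[OF A this] obtain J where "J \<in> \<J>" "\<forall>j\<in>J. mahalanobis A \<beta>' (s j) \<le> c"
      by (auto simp: \<J>_def)
    then have J: "J \<in> \<J>" "(\<beta>', A) \<in> F J" using A \<V> by (auto simp: F_def)
    have "e * norm \<beta>' \<le> E" using e(2)[OF \<beta>'(1)] E[OF J] by linarith
    then have "norm \<beta>' \<le> E / e" using e(1) by (simp add: field_simps)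
    then have "(\<beta>', A) \<in> Q" using A \<beta>'(1) K(2)[OF J] J(1) by (auto simp: Q_def)
    then show ?thesis using R by blast
  qed
  have "compact Q"
    unfolding Q_def
  proof (rule compact_Times[OF _ compact_Int_closed])
    show "compact (W \<inter> cball 0 (E / e))"
      unfolding W_def
      by (intro closed_Int_compact closed_subspace subspace_orthogonal_comp compact_cball)
    show "compact (\<Union>J\<in>\<J>. K J)" using fin K(1) by (rule compact_UN)
  qed (rule \<V>(1))
  moreover have "Q \<noteq> {}" using reduce[OF A0, of \<beta>0] by auto
  moreover have "continuous_on Q (\<lambda>(\<beta>, A). R \<beta> A)"
    unfolding R_def
    by (rule continuous_on_subset[OF continuous_on_mean_loss[OF \<rho> \<sigma>]]) (use \<V>(2) in \<open>auto simp: Q_def\<close>)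
  ultimately have "\<exists>p\<in>Q. \<forall>r\<in>Q. (case p of (\<beta>, A) \<Rightarrow> R \<beta> A) \<le> (case r of (\<beta>, A) \<Rightarrow> R \<beta> A)"
    by (rule continuous_attains_inf)
  then obtain \<beta>1 A1 where 1: "(\<beta>1, A1) \<in> Q" "\<And>\<beta> A. (\<beta>, A) \<in> Q \<Longrightarrow> R \<beta>1 A1 \<le> R \<beta> A"
    by fast
  have "R \<beta>1 A1 \<le> R \<beta> A" if "A \<in> \<V>" for \<beta> A
  proof (cases "R \<beta> A \<le> R \<beta>0 A0")
    case True
    then show ?thesis using reduce[OF that True] 1(2) by metis
  next
    case False
    have "R \<beta>1 A1 \<le> R \<beta>0 A0" using reduce[OF A0, of \<beta>0] 1(2) by (metis order_refl)
    then show ?thesis using False by simp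
  qed
  moreover have "A1 \<in> \<V>" using 1(1) by (simp add: Q_def)
  ultimately show ?thesis unfolding R_def by blast
qed


section \<open>Small mean loss forces many small residuals\<close>

lemma rho_function_saturation:
  assumes "rho_function \<rho>"
  shows "\<exists>c>0. (\<forall>x\<ge>c. \<rho> x = (SUP t. \<rho> t)) \<and> (\<forall>x. \<rho> x \<le> (SUP t. \<rho> t))"
proof -
  obtain c where c: "c > 0" "mono_on {0..c} \<rho>" "\<And>x. x \<ge> c \<Longrightarrow> \<rho> x = \<rho> c"
    and sym: "\<And>x. \<rho> (- x) = \<rho> x"
    using assms unfolding rho_function_def by blast
  have pos: "\<rho> x \<le> \<rho> c" if "0 \<le> x" for x
  proof (cases "x \<le> c")
    case True
    then show ?thesis using c(1) that by (intro mono_onD[OF c(2)]) auto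
  next
    case False
    then have "\<rho> x = \<rho> c" by (intro c(3)) simp
    then show ?thesis by simp
  qed
  have le: "\<rho> x \<le> \<rho> c" for x
    using pos[of x] pos[of "- x"] sym[of x] by (cases "0 \<le> x") simp_all
  have "(SUP t. \<rho> t) = \<rho> c"
    by (rule cSup_eq_maximum) (use le in auto)
  then show ?thesis using c(1) c(3) le by metis
qed

text \<open>
  Each point outside the fitted set contributes the full amount \<open>a\<close> to the sum, so there are at most
  \<open>n * r\<close> of them.
\<close>

lemma mean_loss_small_imp_many_fit:
  assumes c: "\<And>x. x \<ge> c \<Longrightarrow> \<rho> x = a" and a: "a > 0" and nonneg: "\<And>x. 0 \<le> \<rho> x"
    and n: "n > 0" and \<sigma>: "\<sigma> > 0" and le: "mean_loss \<rho> n s \<sigma> \<beta> A \<le> a * r"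
  shows "real n * (1 - r) \<le> real (card {i \<in> {1..n}. mahalanobis A \<beta> (s i) \<le> c * \<sigma>})"
proof -
  let ?d = "\<lambda>i. mahalanobis A \<beta> (s i)"
  define J where "J = {i \<in> {1..n}. ?d i \<le> c * \<sigma>}"
  have J: "J \<subseteq> {1..n}" by (auto simp: J_def)
  have card: "real (card ({1..n} - J)) = real n - real (card J)"
    using J card_mono[of "{1..n}" J] by (subst card_Diff_subset) (auto intro: finite_subset)
  have "a * real (card ({1..n} - J)) = (\<Sum>i\<in>{1..n} - J. a)" by simp
  also have "\<dots> = (\<Sum>i\<in>{1..n} - J. \<rho> (?d i / \<sigma>))"
  proof (rule sum.cong)
    fix i assume "i \<in> {1..n} - J"
    then have "c \<le> ?d i / \<sigma>" using \<sigma> by (auto simp: J_def field_simps)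
    then show "a = \<rho> (?d i / \<sigma>)" by (simp add: c)
  qed simp
  also have "\<dots> \<le> (\<Sum>i=1..n. \<rho> (?d i / \<sigma>))"
    using nonneg by (intro sum_mono2) auto
  also have "\<dots> \<le> a * (real n * r)"
    using le n by (simp add: mean_loss_def field_simps)
  finally have "real (card ({1..n} - J)) \<le> real n * r" using a by simp
  then have "real n * (1 - r) \<le> real (card J)" using card by (simp add: algebra_simps)
  then show ?thesis by (simp only: J_def)
qed

lemma mean_loss_mono:
  assumes "\<And>x. \<rho> x \<le> C * \<rho>' x"
  shows "mean_loss \<rho> n s \<sigma> \<beta> A \<le> C * mean_loss \<rho>' n s \<sigma> \<beta> A"
proof -
  have "mean_loss \<rho> n s \<sigma> \<beta> A
      \<le> (1 / real n) * (\<Sum>i=1..n. C * \<rho>' (mahalanobis A \<beta> (s i) / \<sigma>))"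
    unfolding mean_loss_def using assms by (intro mult_left_mono sum_mono) auto
  also have "\<dots> = C * mean_loss \<rho>' n s \<sigma> \<beta> A"
    by (simp add: mean_loss_def sum_distrib_left)
  finally show ?thesis .
qed

section \<open>Existence of the regression and covariance estimators\<close>

theorem corollary1:
  fixes \<rho>0 \<rho>1 :: "real \<Rightarrow> real"
    and P :: "('k::finite, 'q::finite) point measure"
    and \<X> :: "(real^'q^'k) set"
    and \<Theta> :: "(real^'l::finite) set"
    and V :: "real^'l \<Rightarrow> real^'k^'k"
    and \<beta>0 :: "('k, 'q) point measure \<Rightarrow> real^'q"
    and \<theta>0 :: "('k, 'q) point measure \<Rightarrow> real^'l"
    and s :: "nat \<Rightarrow> ('k, 'q) point"
    and n :: nat and b0 r0 \<sigma>n :: real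
  assumes P: "prob_space P" "sets P = sets borel"
    and \<X>: "minimal_design_set P \<X>"
    and V_PDS: "\<And>\<theta>. \<theta> \<in> \<Theta> \<Longrightarrow> V \<theta> \<in> PDS"
    and V_identifiable: "inj_on V \<Theta>"
    and \<rho>0: "rho_function \<rho>0"
    and \<rho>1: "rho_function \<rho>1"
    and \<rho>1_le: "\<And>x. \<rho>1 x / (SUP t. \<rho>1 t) \<le> \<rho>0 x / (SUP t. \<rho>0 t)"
    and \<rho>1_cont: "continuous_on UNIV \<rho>1"
    and V_cont: "continuous_on \<Theta> V"
    and V_id: "\<exists>\<theta>\<in>\<Theta>. V \<theta> = mat 1"
    and V_scale: "\<And>\<theta> \<alpha>. \<theta> \<in> \<Theta> \<Longrightarrow> \<alpha> > 0 \<Longrightarrow> \<exists>\<theta>'\<in>\<Theta>. \<alpha> *\<^sub>R V \<theta> = V \<theta>'"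
    and V_bdd: "\<And>B. bounded B \<Longrightarrow> bounded {\<theta> \<in> \<Theta>. V \<theta> \<in> B}"
    and V_closed: "closedin (top_of_set PDS) (V ` \<Theta>)"
    and b0: "0 < b0" "b0 < (SUP t. \<rho>0 t)"
    and r0: "r0 = b0 / (SUP t. \<rho>0 t)"
    and s: "\<And>i. i \<in> {1..n} \<Longrightarrow> s i \<in> UNIV \<times> \<X>"
    and \<theta>0n: "\<theta>0 (empirical_measure n s) \<in> \<Theta>"
    and \<sigma>n: "\<sigma>n > 0"
      "mean_loss \<rho>0 n s \<sigma>n (\<beta>0 (empirical_measure n s))
         (shape (V (\<theta>0 (empirical_measure n s)))) = b0"
    and kappa: "real (kappa \<X> n s) + 1 \<le> real n * (1 - r0)"
  shows "\<exists>\<beta>1 \<gamma>. (\<beta>1, \<gamma>) \<in> shape_domain \<Theta> V \<and>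
    (\<forall>(\<beta>, \<gamma>') \<in> shape_domain \<Theta> V.
       mean_loss \<rho>1 n s \<sigma>n \<beta>1 (V \<gamma>) \<le> mean_loss \<rho>1 n s \<sigma>n \<beta> (V \<gamma>')) \<and>
    (\<exists>!\<theta>1. \<theta>1 \<in> \<Theta> \<and> V \<theta>1 = \<sigma>n\<^sup>2 *\<^sub>R V \<gamma>)"
proof -
  let ?R = "\<lambda>\<beta> A. mean_loss \<rho>1 n s \<sigma>n \<beta> A"
  let ?\<beta>0 = "\<beta>0 (empirical_measure n s)" and ?\<theta>0 = "\<theta>0 (empirical_measure n s)"
  define a where "a = (SUP t. \<rho>1 t)"
  define \<V> where "\<V> = {A \<in> V ` \<Theta>. det A = 1}"
  have r0': "0 < r0" "r0 < 1" using b0 by (simp_all add: r0)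
  have n: "n > 0" using kappa by (cases "n = 0") auto
  have "\<X> \<noteq> {}" using \<X> by (auto simp: minimal_design_set_def)
  then have hull: "affine hull \<X> \<noteq> {}" by simp
  have design: "snd (s i) \<in> affine hull \<X>" if "i \<in> {1..n}" for i
    using s[OF that] hull_subset[of \<X> affine] by auto
  have \<rho>1_nonneg: "0 \<le> \<rho>1 x" for x using \<rho>1 by (simp add: rho_function_def)
  obtain c where c: "c > 0" "\<And>x. x \<ge> c \<Longrightarrow> \<rho>1 x = a" "\<And>x. \<rho>1 x \<le> a"
    using rho_function_saturation[OF \<rho>1] by (auto simp: a_def)

  have \<V>: "\<V> \<subseteq> {A. A \<in> PDS \<and> det A = 1}"
    using V_PDS by (auto simp: \<V>_def)
  have "closed \<V>"
  proof -
    obtain U where "closed U" "V ` \<Theta> = PDS \<inter> U"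
      using V_closed by (auto simp: closedin_closed)
    then show ?thesis
      using closed_Int[OF closed_PDS_det_1 \<open>closed U\<close>]
      by (simp add: \<V>_def Collect_conj_eq Int_ac)
  qed
  define A0 where "A0 = shape (V ?\<theta>0)"
  have A0: "A0 \<in> \<V>"
  proof -
    have "V ?\<theta>0 \<in> PDS" using V_PDS \<theta>0n by blast
    then have "det A0 = 1" "0 < 1 / det (V ?\<theta>0) powr (1 / real CARD('k))"
      using PDS_det_pos[of "V ?\<theta>0"] by (simp_all add: A0_def det_shape)
    moreover from this(2) have "A0 \<in> V ` \<Theta>"
      using V_scale[OF \<theta>0n] unfolding A0_def shape_def by (metis imageI)
    ultimately show ?thesis by (simp add: \<V>_def)
  qed

  have "\<exists>\<beta>1. \<exists>A1\<in>\<V>. \<forall>\<beta>. \<forall>A\<in>\<V>. ?R \<beta>1 A1 \<le> ?R \<beta> A"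
  proof (cases "a > 0")
    \<comment> \<open>The definition of a loss function admits the zero function; the normalised inequality is then
      vacuous, as \<open>x / 0 = 0\<close>, but every pair is a minimiser.\<close>
    case False
    then have "\<rho>1 x = 0" for x using c(3)[of x] \<rho>1_nonneg[of x] by simp
    then have "?R \<beta> A = 0" for \<beta> A by (simp add: mean_loss_def)
    then show ?thesis using A0 by auto
  next
    case True
    have "\<rho>1 x \<le> (a / (SUP t. \<rho>0 t)) * \<rho>0 x" for x
      using \<rho>1_le[of x] True b0 by (simp add: a_def field_simps)
    from mean_loss_mono[of \<rho>1, OF this] have start: "?R ?\<beta>0 A0 \<le> a * r0"
      using \<sigma>n(2) by (metis A0_def r0 times_divide_eq_left times_divide_eq_right)
    show ?thesis
    proof (rule mean_loss_attains_minimum[OF \<rho>1_cont _ \<open>closed \<V>\<close> \<V> A0 hull design])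
      show "\<sigma>n \<noteq> 0" using \<sigma>n(1) by simp
    next
      fix \<beta> A assume "?R \<beta> A \<le> ?R ?\<beta>0 A0"
      then have le: "?R \<beta> A \<le> a * r0" using start by simp
      define J where "J = {i \<in> {1..n}. mahalanobis A \<beta> (s i) \<le> c * \<sigma>n}"
      have "real n * (1 - r0) \<le> real (card J)"
        unfolding J_def by (rule mean_loss_small_imp_many_fit[OF c(2) True \<rho>1_nonneg n \<sigma>n(1) le])
      then have "kappa \<X> n s < card J" using kappa by linarith
      then have "\<not> (hyperplane_in \<X> H \<and> s ` J \<subseteq> H)" for H
      proof -
        have "J \<subseteq> {1..n}" by (auto simp: J_def)
        then show ?thesis using card_le_kappa[of \<X> H J n s] \<open>kappa \<X> n s < card J\<close> by linarith
      qed
      moreover have "s ` J \<subseteq> UNIV \<times> (affine hull \<X>)"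
      proof (rule image_subsetI)
        fix j assume "j \<in> J"
        then have "snd (s j) \<in> affine hull \<X>" by (intro design) (simp add: J_def)
        then show "s j \<in> UNIV \<times> (affine hull \<X>)" by (simp add: mem_Times_iff)
      qed
      ultimately have "affine hull (s ` J) = UNIV \<times> (affine hull \<X>)"
        using affine_hull_eq_or_hyperplane_in[OF _ \<open>\<X> \<noteq> {}\<close>, of "s ` J"] by metis
      then show "\<exists>J\<subseteq>{1..n}. affine hull (s ` J) = UNIV \<times> (affine hull \<X>) \<and>
          (\<forall>j\<in>J. mahalanobis A \<beta> (s j) \<le> c * \<sigma>n)"
        by (intro exI[of _ J]) (auto simp: J_def)
    qed
  qed
  then obtain \<beta>1 A1 where A1: "A1 \<in> \<V>" and min: "\<And>\<beta> A. A \<in> \<V> \<Longrightarrow> ?R \<beta>1 A1 \<le> ?R \<beta> A"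
    by blast
  then obtain \<gamma> where \<gamma>: "\<gamma> \<in> \<Theta>" "A1 = V \<gamma>" by (auto simp: \<V>_def)
  have dom: "(\<beta>, \<gamma>') \<in> shape_domain \<Theta> V \<longleftrightarrow> \<gamma>' \<in> \<Theta> \<and> V \<gamma>' \<in> \<V>"
    for \<beta> :: "real^'q" and \<gamma>'
    using V_PDS by (auto simp: shape_domain_def \<V>_def)
  have "\<exists>!\<theta>1. \<theta>1 \<in> \<Theta> \<and> V \<theta>1 = \<sigma>n\<^sup>2 *\<^sub>R V \<gamma>"
  proof -
    have "0 < \<sigma>n\<^sup>2" using \<sigma>n(1) by simp
    from V_scale[OF \<gamma>(1) this] obtain \<theta>1 where \<theta>1: "\<theta>1 \<in> \<Theta>" "V \<theta>1 = \<sigma>n\<^sup>2 *\<^sub>R V \<gamma>" by metis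
    show ?thesis
    proof (rule ex1I[of _ \<theta>1])
      show "\<theta>1 \<in> \<Theta> \<and> V \<theta>1 = \<sigma>n\<^sup>2 *\<^sub>R V \<gamma>" using \<theta>1 by simp
    next
      fix \<theta> assume "\<theta> \<in> \<Theta> \<and> V \<theta> = \<sigma>n\<^sup>2 *\<^sub>R V \<gamma>"
      then show "\<theta> = \<theta>1" using \<theta>1 by (intro inj_onD[OF V_identifiable]) auto
    qed
  qed
  moreover have "(\<beta>1, \<gamma>) \<in> shape_domain \<Theta> V" using A1 \<gamma> by (simp add: dom)
  moreover have "\<forall>(\<beta>, \<gamma>') \<in> shape_domain \<Theta> V. ?R \<beta>1 (V \<gamma>) \<le> ?R \<beta> (V \<gamma>')"
    using min \<gamma> dom by auto
  ultimately show ?thesis by blast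
qed

end
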